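(* Let $\mathbf{X} = \mathbf{Z}\odot_1\boldsymbol{\Omega}_1\cdots\odot_r\boldsymbol{\Omega}_r$ be a random tensor in $\mathbb{R}^{p_1\times\cdots\times p_r}$ following the tensor-valued independent component model (with $\boldsymbol{\mu}=\mathbf{0}$). For each $m=1,\ldots,r$ let $\boldsymbol{\Omega}_m=\mathbf{U}_m\mathbf{D}_m\mathbf{V}_m^\top$ be a singular value decomposition, let $\mathbf{S}_m=\mathrm{cov}_{(m)}(\mathbf{X})$, and let $\mathbf{S}_m^{-1/2}$ be any inverse square root of $\mathbf{S}_m$, written in the form $$\mathbf{S}_m^{-1/2}=\Big(\prod_{s\neq m}p_s^{1/2}\|\mathbf{D}_s\|_F^{-1}\Big)\mathbf{M}_m\mathbf{D}_m^{-1}\mathbf{U}_m^\top$$ with $\mathbf{M}_m\in\mathbb{R}^{p_m\times p_m}$ orthogonal. Then $$\mathbf{X}\odot_1\mathbf{S}_1^{-1/2}\cdots\odot_r\mathbf{S}_r^{-1/2}=\tau\,\mathbf{Z}\odot_1\mathbf{W}_1\cdots\odot_r\mathbf{W}_r,$$ where, for $m=1,\ldots,r$, $\mathbf{W}_m=\mathbf{M}_m\mathbf{V}_m^\top$ is an orthogonal $p_m\times p_m$ matrix and $$\tau=\prod_{m=1}^r\prod_{s\neq m}p_s^{1/2}\|\mathbf{D}_s\|_F^{-1}.$$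
   Context: Tensor-matrix product: for $\mathbf{A}\in\mathbb{R}^{p_1\times\cdots\times p_r}$ and $\mathbf{B}\in\mathbb{R}^{q_m\times p_m}$, $\mathbf{A}\odot_m\mathbf{B}$ is the $p_1\times\cdots\times p_{m-1}\times q_m\times p_{m+1}\times\cdots\times p_r$ tensor with entries $(\mathbf{A}\odot_m\mathbf{B})_{i_1\ldots j_m\ldots i_r}=\sum_{i_m}a_{i_1\ldots i_m\ldots i_r}b_{j_m i_m}$. Successive products are applied from left to right. $m$-mode product of two tensors: for $\mathbf{A},\mathbf{B}\in\mathbb{R}^{p_1\times\cdots\times p_r}$, $\mathbf{A}\odot_{-m}\mathbf{B}$ is the $p_m\times p_m$ matrix whose $(s,t)$ entry is $\sum a_{i_1\ldots i_{m-1}\,s\,i_{m+1}\ldots i_r}\,b_{i_1\ldots i_{m-1}\,t\,i_{m+1}\ldots i_r}$, summed over all $i_j$, $j\neq m$. For a zero-mean random tensor, the $m$-mode covariance matrix is $\mathrm{cov}_{(m)}(\mathbf{X})=\big(\prod_{s\neq m}p_s\big)^{-1}\mathrm{E}(\mathbf{X}\odot_{-m}\mathbf{X})$. Tensor-valued independent component model: $\mathbf{X}=\boldsymbol{\mu}+\mathbf{Z}\odot_1\boldsymbol{\Omega}_1\cdots\odot_r\boldsymbol{\Omega}_r$ with $\boldsymbol{\mu}\in\mathbb{R}^{p_1\times\cdots\times p_r}$, each $\boldsymbol{\Omega}_m\in\mathbb{R}^{p_m\times p_m}$ non-singular, and $\mathbf{Z}\in\mathbb{R}^{p_1\times\cdots\times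 p_r}$ a random tensor such that (1) its components are mutually independent with mean $0$ and variance $1$; (2) for each $m$, at most one $m$-mode face of $\mathbf{Z}$ (a subtensor obtained by fixing the value of the $m$th index) consists entirely of Gaussian components. In the singular value decompositions $\mathbf{U}_m,\mathbf{V}_m$ are orthogonal and $\mathbf{D}_m$ is diagonal with positive diagonal entries; $\|\cdot\|_F$ is the Frobenius norm. An inverse square root of a symmetric positive definite $\mathbf{S}$ is any $\mathbf{G}$ with $\mathbf{G}\mathbf{S}\mathbf{G}^\top=\mathbf{I}$; all inverse square roots of $\mathbf{S}_m$ are of the displayed form. *)

theory Defs
  imports
    "HOL-Probability.Probability"
    "Jordan_Normal_Form.Matrix"
    "Jordan_Normal_Form.Gauss_Jordan_Elimination"
begin

text \<open>
  A tensor of order r with dimensions p 1, ..., p r is a function on multi-indices, of which only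
  the values on the index set below matter. Modes are numbered 1, ..., r as usual; the index within
  each mode m ranges over 0, ..., p m - 1, in accordance with the indexing of matrices.
\<close>

type_synonym tensor = "(nat \<Rightarrow> nat) \<Rightarrow> real"

definition tensor_idx :: "nat set \<Rightarrow> (nat \<Rightarrow> nat) \<Rightarrow> (nat \<Rightarrow> nat) set" where
  "tensor_idx J p = (\<Pi>\<^sub>E m\<in>J. {..<p m})"

text \<open>The range of summation, the m-th dimension of A, is the number of columns of B.\<close>

definition mode_mult :: "nat \<Rightarrow> tensor \<Rightarrow> real mat \<Rightarrow> tensor" where
  "mode_mult m A B = (\<lambda>i. \<Sum>k<dim_col B. A (i(m := k)) * B $$ (i m, k))"

definition multi_mode_mult :: "nat \<Rightarrow> tensor \<Rightarrow> (nat \<Rightarrow> real mat) \<Rightarrow> tensor" where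
  "multi_mode_mult r A B = fold (\<lambda>m T. mode_mult m T (B m)) [1..<Suc r] A"

text \<open>The product of two tensors of the same dimensions over all modes but the m-th.\<close>

definition mode_prod :: "nat \<Rightarrow> (nat \<Rightarrow> nat) \<Rightarrow> nat \<Rightarrow> tensor \<Rightarrow> tensor \<Rightarrow> real mat" where
  "mode_prod r p m A B = Matrix.mat (p m) (p m)
     (\<lambda>(s, t). \<Sum>i\<in>tensor_idx ({1..r} - {m}) p. A (i(m := s)) * B (i(m := t)))"

definition mode_cov ::
  "'a measure \<Rightarrow> nat \<Rightarrow> (nat \<Rightarrow> nat) \<Rightarrow> nat \<Rightarrow> ('a \<Rightarrow> tensor) \<Rightarrow> real mat" where
  "mode_cov P r p m X = inverse (\<Prod>s\<in>{1..r} - {m}. real (p s)) \<cdot>\<^sub>m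
     Matrix.mat (p m) (p m)
       (\<lambda>(s, t). integral\<^sup>L P (\<lambda>\<omega>. mode_prod r p m (X \<omega>) (X \<omega>) $$ (s, t)))"

definition gaussian_rv :: "'a measure \<Rightarrow> ('a \<Rightarrow> real) \<Rightarrow> bool" where
  "gaussian_rv P Y \<longleftrightarrow> (\<exists>\<mu> \<sigma>. 0 < \<sigma> \<and> distributed P lborel Y (normal_density \<mu> \<sigma>))"

text \<open>
  The integrability requirement makes the mean 0 meaningful, since Bochner integrals of
  non-integrable functions are 0 by convention; square integrability is implied by the
  variance being nonzero.
\<close>

definition tensor_ic_model ::
  "'a measure \<Rightarrow> nat \<Rightarrow> (nat \<Rightarrow> nat) \<Rightarrow> tensor \<Rightarrow> (nat \<Rightarrow> real mat) \<Rightarrow>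
   ('a \<Rightarrow> tensor) \<Rightarrow> ('a \<Rightarrow> tensor) \<Rightarrow> bool" where
  "tensor_ic_model P r p \<mu> \<Omega> Z X \<longleftrightarrow>
     prob_space P \<and>
     (\<forall>m\<in>{1..r}. \<Omega> m \<in> carrier_mat (p m) (p m) \<and> invertible_mat (\<Omega> m)) \<and>
     prob_space.indep_vars P (\<lambda>_. borel) (\<lambda>i \<omega>. Z \<omega> i) (tensor_idx {1..r} p) \<and>
     (\<forall>i\<in>tensor_idx {1..r} p.
        integrable P (\<lambda>\<omega>. Z \<omega> i) \<and>
        prob_space.expectation P (\<lambda>\<omega>. Z \<omega> i) = 0 \<and>
        prob_space.variance P (\<lambda>\<omega>. Z \<omega> i) = 1) \<and>
     (\<forall>m\<in>{1..r}. card {k\<in>{..<p m}.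
        \<forall>i\<in>tensor_idx {1..r} p. i m = k \<longrightarrow> gaussian_rv P (\<lambda>\<omega>. Z \<omega> i)} \<le> 1) \<and>
     (\<forall>\<omega>\<in>space P. \<forall>i\<in>tensor_idx {1..r} p.
        X \<omega> i = \<mu> i + multi_mode_mult r (Z \<omega>) \<Omega> i)"

text \<open>
  Orthogonality in the sense of orthonormal columns; the constant orthogonal_mat of
  Jordan_Normal_Form only asks for pairwise orthogonal nonzero columns.
\<close>

definition orthonormal_mat :: "nat \<Rightarrow> real mat \<Rightarrow> bool" where
  "orthonormal_mat n A \<longleftrightarrow> A \<in> carrier_mat n n \<and>
     transpose_mat A * A = 1\<^sub>m n \<and> A * transpose_mat A = 1\<^sub>m n"

definition is_svd :: "nat \<Rightarrow> real mat \<Rightarrow> real mat \<Rightarrow> real mat \<Rightarrow> real mat \<Rightarrow> bool" where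
  "is_svd n A U D V \<longleftrightarrow>
     orthonormal_mat n U \<and> orthonormal_mat n V \<and>
     D \<in> carrier_mat n n \<and> diagonal_mat D \<and> (\<forall>k<n. 0 < D $$ (k, k)) \<and>
     A = U * D * transpose_mat V"

definition frobenius_norm :: "real mat \<Rightarrow> real" where
  "frobenius_norm A = sqrt (\<Sum>i<dim_row A. \<Sum>j<dim_col A. (A $$ (i, j))\<^sup>2)"

text \<open>Only meaningful for invertible matrices.\<close>

definition inv_mat :: "real mat \<Rightarrow> real mat" where
  "inv_mat A = the (mat_inverse A)"

definition is_inv_sqrt_mat :: "nat \<Rightarrow> real mat \<Rightarrow> real mat \<Rightarrow> bool" where
  "is_inv_sqrt_mat n S G \<longleftrightarrow> G \<in> carrier_mat n n \<and> G * S * transpose_mat G = 1\<^sub>m n"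

definition mode_scale :: "nat \<Rightarrow> (nat \<Rightarrow> nat) \<Rightarrow> (nat \<Rightarrow> real mat) \<Rightarrow> nat \<Rightarrow> real" where
  "mode_scale r p D m =
     (\<Prod>s\<in>{1..r} - {m}. sqrt (real (p s)) * inverse (frobenius_norm (D s)))"

end

theory Submission
  imports Defs "Jordan_Normal_Form.Determinant"
begin

text \<open>
  The components of Z are uncorrelated with unit variances, so the covariance of two entries of X is
  a product of entries of the matrices K n = \<Omega> n (\<Omega> n)^T. Summing over all modes but the m-th turns every
  other factor into its trace, which is the squared Frobenius norm of D n; hence the m-mode covariance
  is K m / mode_scale^2. Therefore G m \<Omega> m / mode_scale is orthogonal,
  which yields M m after multiplication by V m. The identity for X follows from
  G m \<Omega> m = mode_scale W m and the functoriality of the simultaneous mode products.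
\<close>

section \<open>Simultaneous mode products as sums over multi-indices\<close>

lemma multi_mode_mult_Suc:
  "multi_mode_mult (Suc r) A B = mode_mult (Suc r) (multi_mode_mult r A B) (B (Suc r))"
  by (simp add: multi_mode_mult_def)

text \<open>The use of \<open>override_on\<close> makes the induction on \<open>r\<close> go
  through: the outermost product, in mode \<open>Suc r\<close>, evaluates the shorter one at
  \<open>i(Suc r := y)\<close>, and the coordinate \<open>y\<close> lies outside
  \<open>{1..r}\<close>, so it has to reach \<open>A\<close> unchanged.\<close>

lemma multi_mode_mult_eq_sum_override:
  "multi_mode_mult r A B i =
    (\<Sum>k\<in>tensor_idx {1..r} (\<lambda>m. dim_col (B m)).
       A (override_on i k {1..r}) * (\<Prod>m\<in>{1..r}. B m $$ (i m, k m)))"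
proof (induction r arbitrary: i)
  case 0
  show ?case by (simp add: multi_mode_mult_def tensor_idx_def)
next
  case (Suc r)
  let ?J = "\<lambda>r. tensor_idx {1..r} (\<lambda>m. dim_col (B m))"
  let ?g = "\<lambda>i k. A (override_on i k {1..Suc r}) * (\<Prod>m\<in>{1..Suc r}. B m $$ (i m, k m))"
  have ins: "{1..Suc r} = insert (Suc r) {1..r}" by auto
  \<comment> \<open>A multi-index of order \<open>Suc r\<close> is a last coordinate
    \<open>y\<close> together with a multi-index of order \<open>r\<close>, so the iterated sum can
    be reindexed into a single one.\<close>
  have J: "?J (Suc r) = (\<lambda>(y, g). g(Suc r := y)) ` ({..<dim_col (B (Suc r))} \<times> ?J r)"
    unfolding tensor_idx_def ins by (rule PiE_insert_eq)
  have inj: "inj_on (\<lambda>(y, g). g(Suc r := y)) ({..<dim_col (B (Suc r))} \<times> ?J r)"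
    unfolding tensor_idx_def by (rule inj_combinator) simp
  have step: "A (override_on (i(Suc r := y)) k {1..r}) *
      (\<Prod>m\<in>{1..r}. B m $$ ((i(Suc r := y)) m, k m)) * B (Suc r) $$ (i (Suc r), y)
      = ?g i (k(Suc r := y))" for y k
  proof -
    have "override_on (i(Suc r := y)) k {1..r} = override_on i (k(Suc r := y)) {1..Suc r}"
      by (auto simp: override_on_def fun_eq_iff)
    moreover have "(\<Prod>m\<in>{1..Suc r}. B m $$ (i m, (k(Suc r := y)) m)) =
        B (Suc r) $$ (i (Suc r), y) * (\<Prod>m\<in>{1..r}. B m $$ (i m, k m))"
      unfolding ins by (subst prod.insert) (auto intro!: prod.cong)
    moreover have "(\<Prod>m\<in>{1..r}. B m $$ ((i(Suc r := y)) m, k m)) =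
        (\<Prod>m\<in>{1..r}. B m $$ (i m, k m))"
      by (rule prod.cong) auto
    ultimately show ?thesis by simp
  qed
  have "multi_mode_mult (Suc r) A B i =
      (\<Sum>y<dim_col (B (Suc r)). \<Sum>k\<in>?J r. ?g i (k(Suc r := y)))"
    by (simp only: multi_mode_mult_Suc mode_mult_def Suc.IH sum_distrib_right step)
  also have "\<dots> = sum (?g i) (?J (Suc r))"
    unfolding J sum.reindex[OF inj] by (simp add: sum.cartesian_product case_prod_unfold o_def)
  finally show ?case .
qed

lemma multi_mode_mult_eq_sum:
  assumes i: "i \<in> tensor_idx {1..r} q" and B: "\<And>m. m \<in> {1..r} \<Longrightarrow> dim_col (B m) = p m"
  shows "multi_mode_mult r A B i =
    (\<Sum>k\<in>tensor_idx {1..r} p. A k * (\<Prod>m\<in>{1..r}. B m $$ (i m, k m)))"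
proof -
  have idx: "tensor_idx {1..r} (\<lambda>m. dim_col (B m)) = tensor_idx {1..r} p"
    unfolding tensor_idx_def by (rule PiE_cong) (simp add: B)
  \<comment> \<open>Both \<open>i\<close> and \<open>k\<close> are extensional: outside
    \<open>{1..r}\<close> they share the value \<open>undefined\<close>, so nothing of
    \<open>i\<close> remains.\<close>
  have "override_on i k {1..r} = k" if "k \<in> tensor_idx {1..r} p" for k
  proof
    fix m
    show "override_on i k {1..r} m = k m"
      using i that by (cases "m \<in> {1..r}") (auto simp: tensor_idx_def PiE_def extensional_def)
  qed
  then show ?thesis
    unfolding multi_mode_mult_eq_sum_override idx by simp
qed

text \<open>Distributivity, the source of every factorisation over modes below: for entries of
  products \<open>C m * B m\<close>, for covariances, and for the traces in the mode
  covariance.\<close>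

lemma prod_sum_tensor_idx:
  "finite J \<Longrightarrow> (\<Sum>k\<in>tensor_idx J p. \<Prod>m\<in>J. f m (k m)) = (\<Prod>m\<in>J. \<Sum>k<p m. f m k)"
  for f :: "nat \<Rightarrow> nat \<Rightarrow> real"
  unfolding tensor_idx_def by (rule prod_sum_PiE[symmetric]) auto

lemma index_mult_mat_sum:
  fixes A B :: "real mat"
  assumes "A \<in> carrier_mat n k" "B \<in> carrier_mat k l" "i < n" "j < l"
  shows "(A * B) $$ (i, j) = (\<Sum>x<k. A $$ (i, x) * B $$ (x, j))"
  using assms by (auto simp: scalar_prod_def lessThan_atLeast0 intro!: sum.cong)

text \<open>Once both sides are sums over multi-indices, interchanging the two sums leaves an inner
  sum over \<open>k\<close> that factorises into entries of \<open>C m * B m\<close>.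
  \<open>Y\<close> is constrained on the index set alone because the model determines
  \<open>X\<close> only there.\<close>

lemma multi_mode_mult_compose:
  assumes i: "i \<in> tensor_idx {1..r} p"
    and B: "\<And>m. m \<in> {1..r} \<Longrightarrow> B m \<in> carrier_mat (p m) (p m)"
    and C: "\<And>m. m \<in> {1..r} \<Longrightarrow> C m \<in> carrier_mat (p m) (p m)"
    and Y: "\<And>k. k \<in> tensor_idx {1..r} p \<Longrightarrow> Y k = multi_mode_mult r A B k"
  shows "multi_mode_mult r Y C i = multi_mode_mult r A (\<lambda>m. C m * B m) i"
proof -
  let ?I = "tensor_idx {1..r} p"
  have dims: "dim_col (B m) = p m" "dim_col (C m) = p m" "dim_col (C m * B m) = p m"
    if "m \<in> {1..r}" for m
    using B[OF that] C[OF that] by auto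
  have entry: "(\<Prod>m\<in>{1..r}. (C m * B m) $$ (i m, l m)) =
      (\<Sum>k\<in>?I. \<Prod>m\<in>{1..r}. C m $$ (i m, k m) * B m $$ (k m, l m))" if l: "l \<in> ?I" for l
    unfolding prod_sum_tensor_idx[where f = "\<lambda>m x. C m $$ (i m, x) * B m $$ (x, l m)",
        OF finite_atLeastAtMost]
  proof (rule prod.cong[OF refl])
    fix m assume m: "m \<in> {1..r}"
    then have "i m < p m" "l m < p m"
      using i l by (auto simp: tensor_idx_def)
    then show "(C m * B m) $$ (i m, l m) = (\<Sum>k<p m. C m $$ (i m, k) * B m $$ (k, l m))"
      by (rule index_mult_mat_sum[OF C[OF m] B[OF m]])
  qed
  have "multi_mode_mult r Y C i = (\<Sum>k\<in>?I. Y k * (\<Prod>m\<in>{1..r}. C m $$ (i m, k m)))"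
    by (rule multi_mode_mult_eq_sum[OF i dims(2)])
  also have "\<dots> = (\<Sum>k\<in>?I. (\<Sum>l\<in>?I. A l * (\<Prod>m\<in>{1..r}. B m $$ (k m, l m))) *
      (\<Prod>m\<in>{1..r}. C m $$ (i m, k m)))"
    by (rule sum.cong[OF refl])
      (simp only: Y multi_mode_mult_eq_sum[where q = p and p = p and B = B, OF _ dims(1)])
  also have "\<dots> = (\<Sum>l\<in>?I. A l *
      (\<Sum>k\<in>?I. \<Prod>m\<in>{1..r}. C m $$ (i m, k m) * B m $$ (k m, l m)))"
    unfolding sum_distrib_right sum_distrib_left
    by (subst sum.swap) (simp add: prod.distrib ac_simps)
  also have "\<dots> = multi_mode_mult r A (\<lambda>m. C m * B m) i"
    by (subst multi_mode_mult_eq_sum[OF i dims(3)]) (simp_all only: entry cong: sum.cong)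
  finally show ?thesis .
qed

text \<open>Multilinearity: each summand contains exactly one entry from every mode, hence each
  scalar \<open>c m\<close> once. This is how the constant \<open>\<tau>\<close> arises.\<close>

lemma multi_mode_mult_smult:
  assumes i: "i \<in> tensor_idx {1..r} p"
    and B: "\<And>m. m \<in> {1..r} \<Longrightarrow> B m \<in> carrier_mat (p m) (p m)"
    and C: "\<And>m. m \<in> {1..r} \<Longrightarrow> C m = c m \<cdot>\<^sub>m B m"
  shows "multi_mode_mult r A C i = (\<Prod>m\<in>{1..r}. c m) * multi_mode_mult r A B i"
proof -
  have dims: "dim_col (B m) = p m" "dim_col (C m) = p m" if "m \<in> {1..r}" for m
    using B[OF that] C[OF that] by auto
  have entry: "(\<Prod>m\<in>{1..r}. C m $$ (i m, k m)) =
      (\<Prod>m\<in>{1..r}. c m) * (\<Prod>m\<in>{1..r}. B m $$ (i m, k m))"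
    if k: "k \<in> tensor_idx {1..r} p" for k
    unfolding prod.distrib[symmetric]
  proof (rule prod.cong[OF refl])
    fix m assume m: "m \<in> {1..r}"
    then have "i m < p m" "k m < p m"
      using i k by (auto simp: tensor_idx_def)
    then show "C m $$ (i m, k m) = c m * B m $$ (i m, k m)"
      using B[OF m] C[OF m] by auto
  qed
  have "multi_mode_mult r A C i =
      (\<Sum>k\<in>tensor_idx {1..r} p. A k * (\<Prod>m\<in>{1..r}. C m $$ (i m, k m)))"
    by (rule multi_mode_mult_eq_sum[OF i dims(2)])
  also have "\<dots> = (\<Prod>m\<in>{1..r}. c m) *
      (\<Sum>k\<in>tensor_idx {1..r} p. A k * (\<Prod>m\<in>{1..r}. B m $$ (i m, k m)))"
    unfolding sum_distrib_left
    by (rule sum.cong[OF refl]) (simp only: entry mult.left_commute)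
  also have "(\<Sum>k\<in>tensor_idx {1..r} p. A k * (\<Prod>m\<in>{1..r}. B m $$ (i m, k m))) =
      multi_mode_mult r A B i"
    by (rule multi_mode_mult_eq_sum[OF i dims(1), symmetric])
  finally show ?thesis .
qed

section \<open>Second moments of independent components and of the model\<close>

lemma (in prob_space) second_moments_of_independent:
  fixes Z :: "'a \<Rightarrow> 'b \<Rightarrow> real"
  assumes ind: "indep_vars (\<lambda>_. borel) (\<lambda>i \<omega>. Z \<omega> i) I"
    and int: "\<And>i. i \<in> I \<Longrightarrow> integrable M (\<lambda>\<omega>. Z \<omega> i)"
    and mean: "\<And>i. i \<in> I \<Longrightarrow> expectation (\<lambda>\<omega>. Z \<omega> i) = 0"
    and var: "\<And>i. i \<in> I \<Longrightarrow> variance (\<lambda>\<omega>. Z \<omega> i) = 1"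
    and k: "k \<in> I" and l: "l \<in> I"
  shows "integrable M (\<lambda>\<omega>. Z \<omega> k * Z \<omega> l)"
    and "expectation (\<lambda>\<omega>. Z \<omega> k * Z \<omega> l) = (if k = l then 1 else 0)"
proof -
  have "integrable M (\<lambda>\<omega>. Z \<omega> k * Z \<omega> l) \<and>
      expectation (\<lambda>\<omega>. Z \<omega> k * Z \<omega> l) = (if k = l then 1 else 0)"
  proof (cases "k = l")
    case True
    have "expectation (\<lambda>\<omega>. Z \<omega> k * Z \<omega> k) = 1"
      using var[OF k] by (simp add: mean[OF k] power2_eq_square)
    \<comment> \<open>A non-integrable function has Bochner integral 0, so the value 1 forces square
      integrability.\<close>
    moreover from this have "integrable M (\<lambda>\<omega>. Z \<omega> k * Z \<omega> k)"
      using not_integrable_integral_eq[of M "\<lambda>\<omega>. Z \<omega> k * Z \<omega> k"] by fastforce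
    ultimately show ?thesis using True by simp
  next
    case False
    have ind': "indep_vars (\<lambda>_. borel) (\<lambda>i \<omega>. Z \<omega> i) {k, l}"
      by (rule indep_vars_subset[OF ind]) (use k l in auto)
    have "integrable M (\<lambda>\<omega>. \<Prod>i\<in>{k, l}. Z \<omega> i)"
      by (rule indep_vars_integrable[OF _ ind']) (use int k l in auto)
    moreover have "expectation (\<lambda>\<omega>. \<Prod>i\<in>{k, l}. Z \<omega> i) = (\<Prod>i\<in>{k, l}. expectation (\<lambda>\<omega>. Z \<omega> i))"
      by (rule indep_vars_lebesgue_integral[OF _ ind']) (use int k l in auto)
    ultimately show ?thesis using False mean[OF k] by simp
  qed
  then show "integrable M (\<lambda>\<omega>. Z \<omega> k * Z \<omega> l)"
    and "expectation (\<lambda>\<omega>. Z \<omega> k * Z \<omega> l) = (if k = l then 1 else 0)"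
    by auto
qed

text \<open>Expanding both entries of \<open>X\<close> gives a double sum over \<open>k\<close> and
  \<open>l\<close> in which only the terms with \<open>k = l\<close> survive the expectation; the
  remaining sum over \<open>k\<close> factorises over the modes. In matrix terms, the covariance of
  the vectorised tensor is a Kronecker product of the matrices
  \<open>\<Omega> m * transpose_mat (\<Omega> m)\<close>.\<close>

lemma tensor_ic_model_second_moments:
  assumes model: "tensor_ic_model P r p (\<lambda>_. 0) \<Omega> Z X"
    and i: "i \<in> tensor_idx {1..r} p" and j: "j \<in> tensor_idx {1..r} p"
  shows "integrable P (\<lambda>\<omega>. X \<omega> i * X \<omega> j)"
    and "integral\<^sup>L P (\<lambda>\<omega>. X \<omega> i * X \<omega> j) =
      (\<Prod>m\<in>{1..r}. (\<Omega> m * transpose_mat (\<Omega> m)) $$ (i m, j m))"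
proof -
  let ?I = "tensor_idx {1..r} p"
  let ?w = "\<lambda>i k. \<Prod>m\<in>{1..r}. \<Omega> m $$ (i m, k m)"
  interpret prob_space P
    using model by (simp add: tensor_ic_model_def)
  have \<Omega>: "\<Omega> m \<in> carrier_mat (p m) (p m)" if "m \<in> {1..r}" for m
    using model that by (auto simp: tensor_ic_model_def)
  have dims: "dim_col (\<Omega> m) = p m" if "m \<in> {1..r}" for m
    using \<Omega>[OF that] by auto
  have fin: "finite ?I"
    unfolding tensor_idx_def by (intro finite_PiE) auto
  have ind: "indep_vars (\<lambda>_. borel) (\<lambda>i \<omega>. Z \<omega> i) ?I"
    and int: "\<And>i. i \<in> ?I \<Longrightarrow> integrable P (\<lambda>\<omega>. Z \<omega> i)"
    and mean: "\<And>i. i \<in> ?I \<Longrightarrow> expectation (\<lambda>\<omega>. Z \<omega> i) = 0"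
    and var: "\<And>i. i \<in> ?I \<Longrightarrow> variance (\<lambda>\<omega>. Z \<omega> i) = 1"
    using model unfolding tensor_ic_model_def by blast+
  have Z: "integrable P (\<lambda>\<omega>. Z \<omega> k * Z \<omega> l)"
      "expectation (\<lambda>\<omega>. Z \<omega> k * Z \<omega> l) = (if k = l then 1 else 0)"
    if "k \<in> ?I" "l \<in> ?I" for k l
    using second_moments_of_independent[OF ind int mean var that] by blast+
  have X: "X \<omega> i * X \<omega> j = (\<Sum>k\<in>?I. \<Sum>l\<in>?I. ?w i k * ?w j l * (Z \<omega> k * Z \<omega> l))"
    if \<omega>: "\<omega> \<in> space P" for \<omega>
  proof -
    have "X \<omega> h = (\<Sum>k\<in>?I. Z \<omega> k * ?w h k)" if h: "h \<in> ?I" for h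
    proof -
      have "X \<omega> h = multi_mode_mult r (Z \<omega>) \<Omega> h"
        using model \<omega> h by (simp add: tensor_ic_model_def)
      also have "\<dots> = (\<Sum>k\<in>?I. Z \<omega> k * ?w h k)"
        by (rule multi_mode_mult_eq_sum[OF h dims])
      finally show ?thesis .
    qed
    then show ?thesis
      by (simp only: i j sum_product ac_simps)
  qed
  show "integrable P (\<lambda>\<omega>. X \<omega> i * X \<omega> j)"
    by (subst Bochner_Integration.integrable_cong[OF refl X], assumption)
      (intro Bochner_Integration.integrable_sum integrable_mult_right Z)
  have "expectation (\<lambda>\<omega>. X \<omega> i * X \<omega> j) =
      expectation (\<lambda>\<omega>. \<Sum>k\<in>?I. \<Sum>l\<in>?I. ?w i k * ?w j l * (Z \<omega> k * Z \<omega> l))"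
    by (rule Bochner_Integration.integral_cong[OF refl X])
  also have "\<dots> = (\<Sum>k\<in>?I. \<Sum>l\<in>?I. ?w i k * ?w j l * (if k = l then 1 else 0))"
    by (simp add: Bochner_Integration.integral_sum Bochner_Integration.integrable_sum
        integrable_mult_right Z cong: sum.cong)
  also have "\<dots> = (\<Sum>k\<in>?I. \<Prod>m\<in>{1..r}. \<Omega> m $$ (i m, k m) * \<Omega> m $$ (j m, k m))"
    by (rule sum.cong[OF refl]) (use fin in \<open>simp add: prod.distrib if_distrib cong: if_cong\<close>)
  also have "\<dots> = (\<Prod>m\<in>{1..r}. \<Sum>k<p m. \<Omega> m $$ (i m, k) * \<Omega> m $$ (j m, k))"
    by (rule prod_sum_tensor_idx) simp
  also have "\<dots> = (\<Prod>m\<in>{1..r}. (\<Omega> m * transpose_mat (\<Omega> m)) $$ (i m, j m))"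
  proof (rule prod.cong[OF refl])
    fix m assume m: "m \<in> {1..r}"
    then have *: "i m < p m" "j m < p m"
      using i j by (auto simp: tensor_idx_def)
    show "(\<Sum>k<p m. \<Omega> m $$ (i m, k) * \<Omega> m $$ (j m, k)) =
        (\<Omega> m * transpose_mat (\<Omega> m)) $$ (i m, j m)"
      using * \<Omega>[OF m] by (subst index_mult_mat_sum[of _ "p m" "p m" _ "p m"]) auto
  qed
  finally show "expectation (\<lambda>\<omega>. X \<omega> i * X \<omega> j) =
      (\<Prod>m\<in>{1..r}. (\<Omega> m * transpose_mat (\<Omega> m)) $$ (i m, j m))" .
qed

section \<open>Frobenius norms and orthogonal matrices\<close>

lemma frobenius_norm_nonneg: "0 \<le> frobenius_norm A"
  by (simp add: frobenius_norm_def sum_nonneg)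

lemma frobenius_norm_transpose: "frobenius_norm (transpose_mat A) = frobenius_norm A"
proof -
  have "(\<Sum>i<dim_col A. \<Sum>j<dim_row A. (transpose_mat A $$ (i, j))\<^sup>2) =
      (\<Sum>i<dim_col A. \<Sum>j<dim_row A. (A $$ (j, i))\<^sup>2)"
    by (intro sum.cong) auto
  also have "\<dots> = (\<Sum>j<dim_row A. \<Sum>i<dim_col A. (A $$ (j, i))\<^sup>2)"
    by (rule sum.swap)
  finally show ?thesis by (simp add: frobenius_norm_def)
qed

lemma frobenius_norm_sq_eq_trace:
  assumes A: "A \<in> carrier_mat n k"
  shows "(frobenius_norm A)\<^sup>2 = (\<Sum>i<n. (A * transpose_mat A) $$ (i, i))"
proof -
  have "(A * transpose_mat A) $$ (i, i) = (\<Sum>j<k. (A $$ (i, j))\<^sup>2)" if "i < n" for i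
    using A that by (subst index_mult_mat_sum[of _ n k _ n]) (auto simp: power2_eq_square)
  then show ?thesis
    using A by (simp add: frobenius_norm_def sum_nonneg)
qed

text \<open>By the trace formula the norm depends on a matrix only through its product with its
  transpose, and there \<open>V * transpose_mat V\<close> drops out.\<close>

lemma frobenius_norm_mult_orthonormal_right:
  assumes A: "A \<in> carrier_mat n k" and V: "orthonormal_mat k V"
  shows "frobenius_norm (A * V) = frobenius_norm A"
proof -
  have V': "V \<in> carrier_mat k k" "V * transpose_mat V = 1\<^sub>m k"
    using V by (auto simp: orthonormal_mat_def)
  have "A * V * transpose_mat (A * V) = A * V * (transpose_mat V * transpose_mat A)"
    by (simp add: transpose_mult[OF A V'(1)])
  also have "\<dots> = A * (V * (transpose_mat V * transpose_mat A))"
    by (rule assoc_mult_mat[of _ n k _ k _ n]) (use A V' in auto)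
  also have "V * (transpose_mat V * transpose_mat A) = V * transpose_mat V * transpose_mat A"
    by (rule assoc_mult_mat[of _ k k _ k _ n, symmetric]) (use A V' in auto)
  also have "V * transpose_mat V * transpose_mat A = transpose_mat A"
    using A V' by simp
  finally have "(frobenius_norm (A * V))\<^sup>2 = (frobenius_norm A)\<^sup>2"
    using frobenius_norm_sq_eq_trace[OF A] frobenius_norm_sq_eq_trace[of "A * V" n k] A V' by simp
  then show ?thesis
    using frobenius_norm_nonneg by (simp add: power2_eq_iff_nonneg)
qed

lemma orthonormal_mat_transpose:
  "orthonormal_mat n A \<Longrightarrow> orthonormal_mat n (transpose_mat A)"
  by (auto simp: orthonormal_mat_def)

text \<open>For square matrices a right inverse is also a left inverse.\<close>

lemma orthonormal_matI:
  assumes A: "A \<in> carrier_mat n n" and AA: "A * transpose_mat A = 1\<^sub>m n"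
  shows "orthonormal_mat n A"
  using mat_mult_left_right_inverse[OF A _ AA] A AA by (simp add: orthonormal_mat_def)

lemma orthonormal_mat_mult:
  assumes A: "orthonormal_mat n A" and B: "orthonormal_mat n B"
  shows "orthonormal_mat n (A * B)"
proof (rule orthonormal_matI)
  have A': "A \<in> carrier_mat n n" "A * transpose_mat A = 1\<^sub>m n"
    and B': "B \<in> carrier_mat n n" "B * transpose_mat B = 1\<^sub>m n"
    using A B by (auto simp: orthonormal_mat_def)
  show "A * B \<in> carrier_mat n n" using A' B' by simp
  have "A * B * transpose_mat (A * B) = A * B * (transpose_mat B * transpose_mat A)"
    by (simp add: transpose_mult[OF A'(1) B'(1)])
  also have "\<dots> = A * (B * (transpose_mat B * transpose_mat A))"
    by (rule assoc_mult_mat[of _ n n _ n _ n]) (use A' B' in auto)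
  also have "B * (transpose_mat B * transpose_mat A) = B * transpose_mat B * transpose_mat A"
    by (rule assoc_mult_mat[of _ n n _ n _ n, symmetric]) (use A' B' in auto)
  finally show "A * B * transpose_mat (A * B) = 1\<^sub>m n"
    using A' B' by simp
qed

text \<open>Invariance is available for factors on the right; the left factor \<open>U\<close> is
  removed after transposing.\<close>

lemma frobenius_norm_svd:
  assumes "is_svd n A U D V"
  shows "frobenius_norm A = frobenius_norm D"
proof -
  have D: "D \<in> carrier_mat n n" and U: "orthonormal_mat n U" and V: "orthonormal_mat n V"
    and A: "A = U * D * transpose_mat V" and Uc: "U \<in> carrier_mat n n"
    using assms by (auto simp: is_svd_def orthonormal_mat_def)
  have "frobenius_norm A = frobenius_norm (U * D)"
    unfolding A using D Uc
    by (intro frobenius_norm_mult_orthonormal_right[of _ n n] orthonormal_mat_transpose V) auto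
  also have "\<dots> = frobenius_norm (transpose_mat D * transpose_mat U)"
    by (simp add: frobenius_norm_transpose transpose_mult[OF Uc D, symmetric])
  also have "\<dots> = frobenius_norm (transpose_mat D)"
    using D by (intro frobenius_norm_mult_orthonormal_right[of _ n n] orthonormal_mat_transpose U) auto
  finally show ?thesis by (simp add: frobenius_norm_transpose)
qed

lemma frobenius_norm_svd_pos:
  assumes "is_svd n A U D V" and "1 \<le> n"
  shows "0 < frobenius_norm D"
proof -
  have D: "D \<in> carrier_mat n n" "0 < D $$ (0, 0)"
    using assms by (auto simp: is_svd_def)
  \<comment> \<open>One positive entry suffices, and \<open>1 \<le> n\<close> guarantees that it
    exists; for \<open>n = 0\<close> the norm is an empty sum.\<close>
  have "0 < (D $$ (0, 0))\<^sup>2" using D by simp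
  also have "\<dots> \<le> (\<Sum>j<n. (D $$ (0, j))\<^sup>2)"
    using assms(2) by (intro member_le_sum) auto
  also have "\<dots> \<le> (\<Sum>i<n. \<Sum>j<n. (D $$ (i, j))\<^sup>2)"
    using assms(2) by (intro member_le_sum[of 0 _ "\<lambda>i. \<Sum>j<n. (D $$ (i, j))\<^sup>2"] sum_nonneg) auto
  finally show ?thesis using D by (simp add: frobenius_norm_def)
qed

section \<open>The mode covariance matrices of the model\<close>

lemma mode_cov_tensor_ic_model:
  assumes model: "tensor_ic_model P r p (\<lambda>_. 0) \<Omega> Z X" and m: "m \<in> {1..r}"
  shows "mode_cov P r p m X = (\<Prod>n\<in>{1..r} - {m}. (frobenius_norm (\<Omega> n))\<^sup>2 / real (p n)) \<cdot>\<^sub>m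
    (\<Omega> m * transpose_mat (\<Omega> m))"
proof -
  let ?K = "\<lambda>n. \<Omega> n * transpose_mat (\<Omega> n)"
  let ?N = "{1..r} - {m}"
  have \<Omega>: "\<Omega> n \<in> carrier_mat (p n) (p n)" if "n \<in> {1..r}" for n
    using model that by (auto simp: tensor_ic_model_def)
  \<comment> \<open>The summation index is \<open>undefined\<close> at \<open>m\<close>; filling in
    \<open>s\<close> there yields a multi-index of full order, to which the second moments
    apply.\<close>
  have upd: "i(m := s) \<in> tensor_idx {1..r} p" if "i \<in> tensor_idx ?N p" "s < p m" for i s
    using that m by (auto simp: tensor_idx_def PiE_def Pi_def extensional_def)
  have "integral\<^sup>L P (\<lambda>\<omega>. mode_prod r p m (X \<omega>) (X \<omega>) $$ (s, t)) =
      (\<Prod>n\<in>?N. (frobenius_norm (\<Omega> n))\<^sup>2) * ?K m $$ (s, t)" if st: "s < p m" "t < p m" for s t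
  proof -
    have "integral\<^sup>L P (\<lambda>\<omega>. mode_prod r p m (X \<omega>) (X \<omega>) $$ (s, t)) =
        integral\<^sup>L P (\<lambda>\<omega>. \<Sum>i\<in>tensor_idx ?N p. X \<omega> (i(m := s)) * X \<omega> (i(m := t)))"
      using st by (simp add: mode_prod_def)
    also have "\<dots> = (\<Sum>i\<in>tensor_idx ?N p. integral\<^sup>L P (\<lambda>\<omega>. X \<omega> (i(m := s)) * X \<omega> (i(m := t))))"
      by (intro Bochner_Integration.integral_sum tensor_ic_model_second_moments(1)[OF model] upd st)
    \<comment> \<open>The two multi-indices differ at most in mode \<open>m\<close>, so every other
      mode contributes a diagonal entry.\<close>
    also have "\<dots> = (\<Sum>i\<in>tensor_idx ?N p. ?K m $$ (s, t) * (\<Prod>n\<in>?N. ?K n $$ (i n, i n)))"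
    proof (rule sum.cong[OF refl])
      fix i assume i: "i \<in> tensor_idx ?N p"
      have "integral\<^sup>L P (\<lambda>\<omega>. X \<omega> (i(m := s)) * X \<omega> (i(m := t))) =
          (\<Prod>n\<in>{1..r}. ?K n $$ ((i(m := s)) n, (i(m := t)) n))"
        by (rule tensor_ic_model_second_moments(2)[OF model upd[OF i st(1)] upd[OF i st(2)]])
      also have "\<dots> = ?K m $$ (s, t) * (\<Prod>n\<in>?N. ?K n $$ (i n, i n))"
        unfolding prod.remove[OF finite_atLeastAtMost m]
        by (intro arg_cong2[of _ _ _ _ "(*)"] prod.cong) auto
      finally show "integral\<^sup>L P (\<lambda>\<omega>. X \<omega> (i(m := s)) * X \<omega> (i(m := t))) = \<dots>" .
    qed
    \<comment> \<open>Summing the products of diagonal entries over all multi-indices gives the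
      product of the traces.\<close>
    also have "\<dots> = ?K m $$ (s, t) * (\<Prod>n\<in>?N. \<Sum>k<p n. ?K n $$ (k, k))"
      unfolding sum_distrib_left[symmetric]
      by (subst prod_sum_tensor_idx[where f = "\<lambda>n k. ?K n $$ (k, k)"]) simp_all
    also have "\<dots> = ?K m $$ (s, t) * (\<Prod>n\<in>?N. (frobenius_norm (\<Omega> n))\<^sup>2)"
      using frobenius_norm_sq_eq_trace[OF \<Omega>] by simp
    finally show ?thesis by simp
  qed
  \<comment> \<open>The normalising constant of \<open>mode_cov\<close> is spread over the modes,
    one \<open>p n\<close> for each trace.\<close>
  moreover have "(\<Prod>n\<in>?N. (frobenius_norm (\<Omega> n))\<^sup>2 / real (p n)) =
      inverse (\<Prod>n\<in>?N. real (p n)) * (\<Prod>n\<in>?N. (frobenius_norm (\<Omega> n))\<^sup>2)"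
    by (simp only: prod_dividef) (simp add: field_simps)
  ultimately show ?thesis
    using \<Omega>[OF m]
    by (intro eq_matI)
      (auto simp: mode_cov_def simp del: index_mult_mat(1))
qed

section \<open>Inverse square roots and singular value decompositions\<close>

lemma inv_mat_svd:
  assumes "is_svd n A U D V"
  shows "inv_mat D \<in> carrier_mat n n" and "D * inv_mat D = 1\<^sub>m n" and "inv_mat D * D = 1\<^sub>m n"
proof -
  have D: "D \<in> carrier_mat n n" "diagonal_mat D" "\<And>k. k < n \<Longrightarrow> 0 < D $$ (k, k)"
    using assms by (auto simp: is_svd_def)
  \<comment> \<open>A triangular matrix is singular only if 0 occurs on its diagonal, and here all
    diagonal entries are positive.\<close>
  have "upper_triangular D"
    using D by (auto simp: diagonal_mat_def)
  then have "det D \<noteq> 0"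
    using D by (auto simp: upper_triangular_imp_det_eq_0_iff[OF D(1)] diag_mat_def
        dest!: D(3))
  \<comment> \<open>Being a unit of the matrix ring rules out the result \<open>None\<close> of
    \<open>mat_inverse\<close>, so \<open>the\<close> in \<open>inv_mat\<close> selects a genuine
    inverse.\<close>
  then have "D \<in> Units (ring_mat TYPE(real) n ())"
    by (rule det_non_zero_imp_unit[OF D(1)])
  then obtain E where "mat_inverse D = Some E"
    using mat_inverse(1)[OF D(1), of "()"] by (cases "mat_inverse D") auto
  then show "inv_mat D \<in> carrier_mat n n" "D * inv_mat D = 1\<^sub>m n" "inv_mat D * D = 1\<^sub>m n"
    using mat_inverse(2)[OF D(1)] by (auto simp: inv_mat_def)
qed

lemma smult_smult_mat: "a \<cdot>\<^sub>m (b \<cdot>\<^sub>m A) = (a * b) \<cdot>\<^sub>m A" for a b :: real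
  by (intro eq_matI) auto

lemma one_smult_mat: "1 \<cdot>\<^sub>m A = A" for A :: "real mat"
  by (intro eq_matI) auto

lemma transpose_smult_mat: "transpose_mat (c \<cdot>\<^sub>m A) = c \<cdot>\<^sub>m transpose_mat A" for c :: real
  by (intro eq_matI) auto

text \<open>Multiplying \<open>c G A\<close> by its transpose regroups to
  \<open>G (c^2 A A^T) G^T\<close>, which is the identity by the choice of \<open>G\<close>. The
  scalar is given as a square so that each of the two factors receives one \<open>c\<close>.\<close>

lemma orthonormal_mat_inv_sqrt_mult:
  assumes G: "is_inv_sqrt_mat n (c\<^sup>2 \<cdot>\<^sub>m (A * transpose_mat A)) G" and A: "A \<in> carrier_mat n n"
  shows "orthonormal_mat n (c \<cdot>\<^sub>m (G * A))"
proof (rule orthonormal_matI)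
  have G': "G \<in> carrier_mat n n"
    "G * (c\<^sup>2 \<cdot>\<^sub>m (A * transpose_mat A)) * transpose_mat G = 1\<^sub>m n"
    using G by (auto simp: is_inv_sqrt_mat_def)
  have GA: "G * A \<in> carrier_mat n n" using G' A by simp
  have AA: "A * transpose_mat A \<in> carrier_mat n n" using A by simp
  show "c \<cdot>\<^sub>m (G * A) \<in> carrier_mat n n" using GA by simp
  have "transpose_mat (c \<cdot>\<^sub>m (G * A)) = c \<cdot>\<^sub>m (transpose_mat A * transpose_mat G)"
    using transpose_mult[OF G'(1) A] by (simp add: transpose_smult_mat)
  then have "c \<cdot>\<^sub>m (G * A) * transpose_mat (c \<cdot>\<^sub>m (G * A)) =
      c\<^sup>2 \<cdot>\<^sub>m (G * A * (transpose_mat A * transpose_mat G))"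
    using A G' by (simp add: mult_smult_assoc_mat[OF GA, of _ n]
        mult_smult_distrib[OF GA, of _ n] power2_eq_square smult_smult_mat)
  also have "G * A * (transpose_mat A * transpose_mat G) =
      G * A * transpose_mat A * transpose_mat G"
    by (rule assoc_mult_mat[of _ n n _ n _ n, symmetric]) (use A G' in auto)
  also have "G * A * transpose_mat A = G * (A * transpose_mat A)"
    by (rule assoc_mult_mat[of _ n n _ n _ n]) (use A G' in auto)
  also have "c\<^sup>2 \<cdot>\<^sub>m (G * (A * transpose_mat A) * transpose_mat G) =
      G * (c\<^sup>2 \<cdot>\<^sub>m (A * transpose_mat A)) * transpose_mat G"
    using A G' by (simp add: mult_smult_assoc_mat[of _ n n _ n] mult_smult_distrib[OF _ AA])
  finally show "c \<cdot>\<^sub>m (G * A) * transpose_mat (c \<cdot>\<^sub>m (G * A)) = 1\<^sub>m n"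
    using G' by simp
qed

text \<open>Here \<open>A V D^-1 U^T = U D D^-1 U^T = I\<close>. This shows that the orthogonal
  matrix constructed in the theorem does reproduce \<open>G\<close>.\<close>

lemma svd_cancel_right:
  assumes svd: "is_svd n A U D V" and G: "G \<in> carrier_mat n n"
  shows "G * A * V * inv_mat D * transpose_mat U = G"
proof -
  have c: "U \<in> carrier_mat n n" "D \<in> carrier_mat n n" "V \<in> carrier_mat n n"
    and VV: "transpose_mat V * V = 1\<^sub>m n" and UU: "U * transpose_mat U = 1\<^sub>m n"
    and A: "A = U * D * transpose_mat V"
    using svd by (auto simp: is_svd_def orthonormal_mat_def)
  note E = inv_mat_svd[OF svd]
  note assoc = assoc_mult_mat[of _ n n _ n _ n]
  have "G * A * V = G * (U * D * (transpose_mat V * V))"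
    using c G unfolding A by (simp add: assoc)
  also have "\<dots> = G * (U * D)"
    using c by (simp add: VV)
  finally have "G * A * V * inv_mat D * transpose_mat U =
      G * (U * (D * inv_mat D) * transpose_mat U)"
    using c G E(1) by (simp add: assoc)
  also have "\<dots> = G"
    using c G by (simp add: E UU)
  finally show ?thesis .
qed

text \<open>Here \<open>D^-1 U^T A = V^T\<close>. With \<open>A = \<Omega> m\<close> this is where
  \<open>W m = M m * transpose_mat (V m)\<close> comes from.\<close>

lemma svd_cancel_left:
  assumes svd: "is_svd n A U D V" and M: "M \<in> carrier_mat n n"
  shows "M * inv_mat D * transpose_mat U * A = M * transpose_mat V"
proof -
  have c: "U \<in> carrier_mat n n" "D \<in> carrier_mat n n" "V \<in> carrier_mat n n"
    and UU: "transpose_mat U * U = 1\<^sub>m n"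
    and A: "A = U * D * transpose_mat V"
    using svd by (auto simp: is_svd_def orthonormal_mat_def)
  note E = inv_mat_svd[OF svd]
  note assoc = assoc_mult_mat[of _ n n _ n _ n]
  have "M * inv_mat D * transpose_mat U * A =
      M * (inv_mat D * ((transpose_mat U * U) * (D * transpose_mat V)))"
    using c M E(1) unfolding A by (simp add: assoc)
  also have "\<dots> = M * ((inv_mat D * D) * transpose_mat V)"
    using c E(1) by (simp add: UU assoc)
  also have "\<dots> = M * transpose_mat V"
    using c by (simp add: E)
  finally show ?thesis .
qed

section \<open>The scaling constants and the standardised tensor\<close>

lemma mode_scale_pos:
  assumes "\<And>n. n \<in> {1..r} \<Longrightarrow> 1 \<le> p n" "\<And>n. n \<in> {1..r} \<Longrightarrow> 0 < frobenius_norm (D n)"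
  shows "0 < mode_scale r p D m"
  unfolding mode_scale_def using assms
  by (intro prod_pos) (fastforce simp: Suc_le_eq)

text \<open>Matches the scalar found in \<open>mode_cov_tensor_ic_model\<close>, once the norms of
  the \<open>\<Omega> n\<close> are replaced by those of the \<open>D n\<close>.\<close>

lemma inverse_mode_scale_sq:
  "(inverse (mode_scale r p D m))\<^sup>2 = (\<Prod>n\<in>{1..r} - {m}. (frobenius_norm (D n))\<^sup>2 / real (p n))"
proof -
  have "(inverse (mode_scale r p D m))\<^sup>2 =
      (\<Prod>n\<in>{1..r} - {m}. (inverse (sqrt (real (p n)) * inverse (frobenius_norm (D n))))\<^sup>2)"
    unfolding mode_scale_def by (simp only: prod_inversef[symmetric] prod_power_distrib o_def)
  also have "\<dots> = (\<Prod>n\<in>{1..r} - {m}. (frobenius_norm (D n))\<^sup>2 / real (p n))"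
    by (intro prod.cong) (simp_all add: power_mult_distrib power_inverse divide_inverse)
  finally show ?thesis .
qed

theorem theorem5p3p1:
  fixes P :: "'a measure" and r :: nat and p :: "nat \<Rightarrow> nat"
    and X Z :: "'a \<Rightarrow> tensor" and \<Omega> U D V S G :: "nat \<Rightarrow> real mat"
  assumes "1 \<le> r" and "\<And>m. m \<in> {1..r} \<Longrightarrow> 1 \<le> p m"
    and "tensor_ic_model P r p (\<lambda>_. 0) \<Omega> Z X"
    and "\<And>m. m \<in> {1..r} \<Longrightarrow> is_svd (p m) (\<Omega> m) (U m) (D m) (V m)"
    and "\<And>m. m \<in> {1..r} \<Longrightarrow> S m = mode_cov P r p m X"
    and "\<And>m. m \<in> {1..r} \<Longrightarrow> is_inv_sqrt_mat (p m) (S m) (G m)"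
  defines "represents \<equiv> (\<lambda>M :: nat \<Rightarrow> real mat. \<forall>m\<in>{1..r}. orthonormal_mat (p m) (M m) \<and>
      G m = mode_scale r p D m \<cdot>\<^sub>m (M m * inv_mat (D m) * transpose_mat (U m)))"
    and "\<tau> \<equiv> \<Prod>m\<in>{1..r}. mode_scale r p D m"
  shows "(\<exists>M. represents M) \<and>
    (\<forall>M W. represents M \<longrightarrow> (\<forall>m\<in>{1..r}. W m = M m * transpose_mat (V m)) \<longrightarrow>
      (\<forall>m\<in>{1..r}. orthonormal_mat (p m) (W m)) \<and>
      (\<forall>\<omega>\<in>space P. \<forall>i\<in>tensor_idx {1..r} p.
        multi_mode_mult r (X \<omega>) G i = \<tau> * multi_mode_mult r (Z \<omega>) W i))"
proof -
  note p = assms(2) and model = assms(3) and svd = assms(4) and S = assms(5) and G = assms(6)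
  let ?c = "mode_scale r p D"
  have frob: "0 < frobenius_norm (D m)" if "m \<in> {1..r}" for m
    by (rule frobenius_norm_svd_pos[OF svd[OF that] p[OF that]])
  have cpos: "0 < ?c m" for m
    by (rule mode_scale_pos[OF p frob])
  have \<Omega>: "\<Omega> m \<in> carrier_mat (p m) (p m)" if "m \<in> {1..r}" for m
    using model that by (auto simp: tensor_ic_model_def)
  have Gc: "G m \<in> carrier_mat (p m) (p m)" if "m \<in> {1..r}" for m
    using G[OF that] by (simp add: is_inv_sqrt_mat_def)
  have Sm: "S m = (inverse (?c m))\<^sup>2 \<cdot>\<^sub>m (\<Omega> m * transpose_mat (\<Omega> m))" if m: "m \<in> {1..r}" for m
    unfolding S[OF m] mode_cov_tensor_ic_model[OF model m] inverse_mode_scale_sq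
    using frobenius_norm_svd[OF svd] by simp
  \<comment> \<open>The witness solves \<open>G = c M D^-1 U^T\<close> for \<open>M\<close>: it
    gives \<open>M = c^-1 G U D\<close>, and \<open>U D = \<Omega> V\<close>. It is orthogonal as
    the product of \<open>c^-1 G \<Omega>\<close> and \<open>V\<close>.\<close>
  have "represents (\<lambda>m. inverse (?c m) \<cdot>\<^sub>m (G m * \<Omega> m) * V m)"
    unfolding represents_def
  proof (intro ballI conjI)
    fix m assume m: "m \<in> {1..r}"
    have V: "orthonormal_mat (p m) (V m)" "V m \<in> carrier_mat (p m) (p m)"
      and U: "U m \<in> carrier_mat (p m) (p m)"
      using svd[OF m] by (auto simp: is_svd_def orthonormal_mat_def)
    note E = inv_mat_svd(1)[OF svd[OF m]]
    have c: "G m * \<Omega> m \<in> carrier_mat (p m) (p m)"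
      "G m * \<Omega> m * V m \<in> carrier_mat (p m) (p m)"
      "G m * \<Omega> m * V m * inv_mat (D m) \<in> carrier_mat (p m) (p m)"
      using Gc[OF m] \<Omega>[OF m] V(2) E by auto
    show "orthonormal_mat (p m) (inverse (?c m) \<cdot>\<^sub>m (G m * \<Omega> m) * V m)"
      using G[OF m] unfolding Sm[OF m]
      by (intro orthonormal_mat_mult orthonormal_mat_inv_sqrt_mult V \<Omega>[OF m])
    have "inverse (?c m) \<cdot>\<^sub>m (G m * \<Omega> m) * V m * inv_mat (D m) * transpose_mat (U m) =
        inverse (?c m) \<cdot>\<^sub>m (G m * \<Omega> m * V m * inv_mat (D m) * transpose_mat (U m))"
      using U by (simp only: mult_smult_assoc_mat[OF c(1) V(2)] mult_smult_assoc_mat[OF c(2) E]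
          mult_smult_assoc_mat[OF c(3), of _ "p m"] transpose_carrier_mat)
    also have "\<dots> = inverse (?c m) \<cdot>\<^sub>m G m"
      by (simp add: svd_cancel_right[OF svd[OF m] Gc[OF m]])
    finally show "G m = ?c m \<cdot>\<^sub>m
        (inverse (?c m) \<cdot>\<^sub>m (G m * \<Omega> m) * V m * inv_mat (D m) * transpose_mat (U m))"
      using cpos[of m] by (simp add: smult_smult_mat one_smult_mat)
  qed
  \<comment> \<open>From here \<open>M\<close> is an arbitrary representing family, not just the
    witness above.\<close>
  moreover have "(\<forall>m\<in>{1..r}. orthonormal_mat (p m) (W m)) \<and>
      (\<forall>\<omega>\<in>space P. \<forall>i\<in>tensor_idx {1..r} p.
        multi_mode_mult r (X \<omega>) G i = \<tau> * multi_mode_mult r (Z \<omega>) W i)"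
    if rep: "represents M" and W: "\<forall>m\<in>{1..r}. W m = M m * transpose_mat (V m)" for M W
  proof (intro conjI ballI)
    have M: "orthonormal_mat (p m) (M m)" "M m \<in> carrier_mat (p m) (p m)"
      "G m = ?c m \<cdot>\<^sub>m (M m * inv_mat (D m) * transpose_mat (U m))" if "m \<in> {1..r}" for m
      using rep that by (auto simp: represents_def orthonormal_mat_def)
    show Worth: "orthonormal_mat (p m) (W m)" if m: "m \<in> {1..r}" for m
      using svd[OF m] M(1)[OF m] W m
      by (auto simp: is_svd_def intro!: orthonormal_mat_mult orthonormal_mat_transpose)
    \<comment> \<open>Whitening cancels \<open>U m\<close> and \<open>D m\<close> in mode
      \<open>m\<close>, leaving an orthogonal matrix and the scalar \<open>?c m\<close>; these
      scalars multiply to \<open>\<tau>\<close>.\<close>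
    have GW: "G m * \<Omega> m = ?c m \<cdot>\<^sub>m W m" if m: "m \<in> {1..r}" for m
    proof -
      have U: "U m \<in> carrier_mat (p m) (p m)"
        using svd[OF m] by (auto simp: is_svd_def orthonormal_mat_def)
      have "G m * \<Omega> m = ?c m \<cdot>\<^sub>m (M m * inv_mat (D m) * transpose_mat (U m) * \<Omega> m)"
        unfolding M(3)[OF m] using U M(2)[OF m] inv_mat_svd(1)[OF svd[OF m]] \<Omega>[OF m]
        by (simp add: mult_smult_assoc_mat[of _ "p m" "p m" _ "p m"])
      then show ?thesis
        using W m by (simp add: svd_cancel_left[OF svd[OF m] M(2)[OF m]])
    qed
    fix \<omega> i assume \<omega>: "\<omega> \<in> space P" and i: "i \<in> tensor_idx {1..r} p"
    have X: "X \<omega> k = multi_mode_mult r (Z \<omega>) \<Omega> k" if "k \<in> tensor_idx {1..r} p" for k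
      using model \<omega> that by (simp add: tensor_ic_model_def)
    have "multi_mode_mult r (X \<omega>) G i = multi_mode_mult r (Z \<omega>) (\<lambda>m. G m * \<Omega> m) i"
      by (rule multi_mode_mult_compose[OF i \<Omega> Gc X])
    also have "\<dots> = \<tau> * multi_mode_mult r (Z \<omega>) W i"
      unfolding \<tau>_def
      by (rule multi_mode_mult_smult[OF i _ GW]) (use Worth in \<open>auto simp: orthonormal_mat_def\<close>)
    finally show "multi_mode_mult r (X \<omega>) G i = \<tau> * multi_mode_mult r (Z \<omega>) W i" .
  qed
  ultimately show ?thesis by blast
qed

end
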